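(* Suppose that $P(G_i=1)\in(0,1)$, let $\omega_i=(\alpha_i,\varepsilon_i^1,\mu_i,\eta_i^1)$, and suppose that there are constants $\rho_1,\rho_2\in\mathbb{R}$ such that $$E[\dot Y_{it}(0)\mid\alpha_i,\varepsilon_i^{t-1},\mu_i,\eta_i^{t-1}]=\rho_t\,\dot Y_{i(t-1)}(0)\quad\text{a.s.},\qquad t=1,2.$$ Define $\zeta_{i2}=\dot Y_{i2}(0)-\rho_2\dot Y_{i1}(0)$ and $$\Delta^{\mathrm{sel}}_{\mathrm{post}}=\frac{E\big[(G_i-E[G_i\mid\omega_i])(\dot Y_{i2}(0)-\dot Y_{i1}(0))\big]}{P(G_i=1)P(G_i=0)},\qquad \Delta^{\mathrm{dev}}_{\mathrm{post}}=\frac{E\big[E[G_i\mid\omega_i]\,E[\dot Y_{i2}(0)-\dot Y_{i1}(0)\mid\omega_i]\big]}{P(G_i=1)P(G_i=0)}.$$ Then $$\Delta^{\mathrm{sel}}_{\mathrm{post}}=E[\zeta_{i2}\mid G_i=1]-E[\zeta_{i2}\mid G_i=0],$$ $$\Delta^{\mathrm{dev}}_{\mathrm{post}}=(\rho_2-1)\big(E[Y_{i1}\mid G_i=1]-E[Y_{i1}\mid G_i=0]\big).$$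
   Context: For a generic unit $i$ and periods $t\in\{0,1,2\}$, the untreated potential outcomes are real-valued with $Y_{it}(0)=\xi_t(\alpha_i,\varepsilon_{it})$, where $\alpha_i,\varepsilon_{i0},\varepsilon_{i1},\varepsilon_{i2}$ are finite-dimensional random vectors and $\xi_t$ are arbitrary (measurable) functions; $\mu_i,\eta_{i0},\eta_{i1},\eta_{i2}$ are additional unobservable random vectors. Write $\varepsilon_i^{t}=(\varepsilon_{i0},\dots,\varepsilon_{it})$ and $\eta_i^t=(\eta_{i0},\dots,\eta_{it})$ (so $\varepsilon_i^0=\varepsilon_{i0}$, $\eta_i^0=\eta_{i0}$). $\dot Y_{it}(0)=Y_{it}(0)-E[Y_{it}(0)]$. $G_i\in\{0,1\}$ is the treatment-group indicator; treatment occurs only at $t=2$ and only for $G_i=1$, and there is no anticipation, so the observed outcome in period 1 is $Y_{i1}=Y_{i1}(0)$. All relevant moments exist (in particular $E|Y_{it}(0)|<\infty$). *)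

theory Defs
  imports "HOL-Probability.Probability"
begin

text \<open>A version of \<open>E[X | Z]\<close> for a random vector \<open>Z\<close>: conditioning is on the
  sigma-algebra generated by \<open>Z\<close>.\<close>

definition cond_exp_rv ::
    "'w measure \<Rightarrow> ('w \<Rightarrow> real) \<Rightarrow> ('w \<Rightarrow> 'z::topological_space) \<Rightarrow> 'w \<Rightarrow> real" where
  "cond_exp_rv M X Z = real_cond_exp M (vimage_algebra (space M) Z borel) X"

text \<open>\<open>E[X | A]\<close> for an event \<open>A\<close> of positive probability: the mean of \<open>X\<close> under
  \<open>P(\<cdot> | A)\<close>.\<close>

definition cond_exp_event :: "'w measure \<Rightarrow> ('w \<Rightarrow> real) \<Rightarrow> 'w set \<Rightarrow> real" where
  "cond_exp_event M X A = (\<integral>w. X w \<partial>(uniform_measure M A))"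

definition centered :: "'w measure \<Rightarrow> ('w \<Rightarrow> real) \<Rightarrow> 'w \<Rightarrow> real" where
  "centered M X w = X w - (\<integral>v. X v \<partial>M)"

definition group_event :: "'w measure \<Rightarrow> ('w \<Rightarrow> real) \<Rightarrow> real \<Rightarrow> 'w set" where
  "group_event M G g = {w \<in> space M. G w = g}"

text \<open>\<open>Y1\<close> is the path of potential outcomes if the unit belongs to the treated group,
  \<open>Y0\<close> the untreated path; both are indexed by the period.\<close>

definition observed_outcome ::
    "('w \<Rightarrow> real) \<Rightarrow> (nat \<Rightarrow> 'w \<Rightarrow> real) \<Rightarrow> (nat \<Rightarrow> 'w \<Rightarrow> real) \<Rightarrow> nat \<Rightarrow> 'w \<Rightarrow> real" where
  "observed_outcome G Y0 Y1 t w = (if G w = 1 then Y1 t w else Y0 t w)"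

definition delta_sel_post ::
    "'w measure \<Rightarrow> ('w \<Rightarrow> real) \<Rightarrow> ('w \<Rightarrow> 'z::topological_space) \<Rightarrow> (nat \<Rightarrow> 'w \<Rightarrow> real) \<Rightarrow> real" where
  "delta_sel_post M G Z Y0 =
     (\<integral>w. (G w - cond_exp_rv M G Z w) * (centered M (Y0 2) w - centered M (Y0 1) w) \<partial>M)
       / (measure M (group_event M G 1) * measure M (group_event M G 0))"

definition delta_dev_post ::
    "'w measure \<Rightarrow> ('w \<Rightarrow> real) \<Rightarrow> ('w \<Rightarrow> 'z::topological_space) \<Rightarrow> (nat \<Rightarrow> 'w \<Rightarrow> real) \<Rightarrow> real" where
  "delta_dev_post M G Z Y0 =
     (\<integral>w. cond_exp_rv M G Z w
          * cond_exp_rv M (\<lambda>v. centered M (Y0 2) v - centered M (Y0 1) v) Z w \<partial>M)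
       / (measure M (group_event M G 1) * measure M (group_event M G 0))"

end

theory Submission
  imports Defs
begin

text \<open>Write \<open>F\<close> for the sigma-algebra generated by \<open>\<omega>\<close> and \<open>D\<^sub>t\<close> for the centered untreated outcomes. By
  assumption \<open>E[D\<^sub>2 - D\<^sub>1 | F] = (\<rho>\<^sub>2 - 1) D\<^sub>1\<close>, because \<open>D\<^sub>1\<close> is \<open>F\<close>-measurable. Since \<open>E[G | F]\<close> is bounded
  and conditional expectation is self-adjoint, \<open>E[E[G | F] (D\<^sub>2 - D\<^sub>1)] = E[E[G | F] (\<rho>\<^sub>2 - 1) D\<^sub>1] =
  (\<rho>\<^sub>2 - 1) E[G D\<^sub>1]\<close>, so the two numerators are \<open>E[G \<zeta>\<^sub>2]\<close> and \<open>(\<rho>\<^sub>2 - 1) E[G D\<^sub>1]\<close>. Finally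
  \<open>E[X | G = 1] - E[X | G = 0] = Cov(G, X) / (P(G = 1) P(G = 0))\<close>, and both \<open>\<zeta>\<^sub>2\<close> and \<open>D\<^sub>1\<close> have mean zero.\<close>

lemma (in finite_measure) cond_exp_event_eq:
  assumes [measurable]: "A \<in> sets M" "X \<in> borel_measurable M" and pos: "measure M A > 0"
  shows "cond_exp_event M X A = (\<integral>w. indicator A w * X w \<partial>M) / measure M A"
proof -
  \<comment> \<open>Positivity of \<open>measure M A\<close> turns the extended nonnegative quotient
    into a real density, the form that \<open>integral_real_density\<close> accepts.\<close>
  have "indicator A w / emeasure M A = ennreal (indicator A w / measure M A)" for w
    using pos by (auto simp: emeasure_eq_measure divide_ennreal ennreal_divide_self
        simp flip: ennreal_1 split: split_indicator)
  then have "cond_exp_event M X A = (\<integral>w. (indicator A w / measure M A) * X w \<partial>M)"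
    by (simp add: cond_exp_event_def uniform_measure_def integral_real_density)
  also have "\<dots> = (\<integral>w. (indicator A w * X w) / measure M A \<partial>M)"
    by (simp add: field_simps)
  finally show ?thesis by simp
qed

text \<open>The measure \<open>uniform_measure M A\<close> sees \<open>X\<close> only on
  \<open>A\<close> and up to null sets of \<open>M\<close>. So an almost sure condition such as no
  anticipation suffices to exchange outcomes inside a conditional mean.\<close>

lemma cond_exp_event_cong_AE:
  assumes [measurable]: "A \<in> sets M" "X \<in> borel_measurable M" "X' \<in> borel_measurable M"
    and "AE w in M. w \<in> A \<longrightarrow> X w = X' w"
  shows "cond_exp_event M X A = cond_exp_event M X' A"
  unfolding cond_exp_event_def
  by (rule integral_cong_AE) (use assms in \<open>auto intro!: AE_uniform_measureI\<close>)

lemma group_event_sets: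
  assumes [measurable]: "G \<in> borel_measurable M"
  shows "group_event M G g \<in> sets M"
  unfolding group_event_def by measurable

text \<open>\<open>G\<close> is the indicator of the event \<open>G = 1\<close>. With p = P(G = 1),
  q = 1 - p, a = E[G X] and e = E[X], the two conditional means are a / p and (e - a) / q. Their
  difference is (a - p e) / (p q), and a - p e = E[G (X - e)] because E[G] = p.\<close>

lemma (in prob_space) cond_exp_event_group_diff:
  assumes G [measurable]: "G \<in> borel_measurable M"
    and "G \<in> space M \<rightarrow> {0, 1}"
    and p: "prob (group_event M G 1) \<in> {0<..<1}"
    and X: "integrable M X"
  shows "cond_exp_event M X (group_event M G 1) - cond_exp_event M X (group_event M G 0)
    = expectation (\<lambda>w. G w * centered M X w)
      / (prob (group_event M G 1) * prob (group_event M G 0))"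
proof -
  let ?p = "prob (group_event M G 1)" and ?q = "prob (group_event M G 0)"
  have G01: "G w \<in> {0, 1}" if "w \<in> space M" for w
    using assms(2) that by blast
  note sets [measurable] = group_event_sets[OF G]
  have [measurable]: "X \<in> borel_measurable M" using X by simp
  have "group_event M G 0 = space M - group_event M G 1"
    using G01 by (auto simp: group_event_def)
  then have q: "?q = 1 - ?p" by (simp add: prob_compl sets)
  have ind1: "indicator (group_event M G 1) w = G w"
    and ind0: "indicator (group_event M G 0) w = 1 - G w" if "w \<in> space M" for w
    using G01[OF that] that by (auto simp: group_event_def)
  have intGX: "integrable M (\<lambda>w. G w * X w)"
    by (rule Bochner_Integration.integrable_bound[OF X]) (use X in \<open>auto intro!: AE_I2 dest: G01\<close>)
  have intG: "integrable M G"
    by (rule integrable_const_bound[where B = 1]) (auto intro!: AE_I2 dest: G01)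
  have "expectation G = expectation (indicator (group_event M G 1))"
    by (intro Bochner_Integration.integral_cong) (auto simp: ind1)
  then have EG: "expectation G = ?p" by simp
  have "cond_exp_event M X (group_event M G 1) = expectation (\<lambda>w. G w * X w) / ?p"
    using p by (subst cond_exp_event_eq)
      (auto simp: ind1 sets cong: Bochner_Integration.integral_cong)
  moreover have "cond_exp_event M X (group_event M G 0)
      = expectation (\<lambda>w. X w - G w * X w) / ?q"
    using p q by (subst cond_exp_event_eq)
      (auto simp: ind0 sets algebra_simps cong: Bochner_Integration.integral_cong)
  moreover have "expectation (\<lambda>w. X w - G w * X w)
      = expectation X - expectation (\<lambda>w. G w * X w)"
    using X intGX by simp
  moreover have "expectation (\<lambda>w. G w * centered M X w)
      = expectation (\<lambda>w. G w * X w) - ?p * expectation X"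
    using intGX intG by (simp add: centered_def right_diff_distrib EG)
  moreover have "a / ?p - (e - a) / ?q = (a - ?p * e) / (?p * ?q)" for a e :: real
    using p unfolding q by (simp add: divide_simps) (simp add: algebra_simps)
  ultimately show ?thesis by simp
qed

text \<open>Conditional expectation preserves the bounds -B and B, so the product is dominated by B
  |X|. Boundedness is what makes the product integrable when \<open>X\<close> is merely
  integrable.\<close>

lemma (in sigma_finite_subalgebra) integrable_real_cond_exp_mult_bounded:
  assumes g: "integrable M g" and bound: "AE w in M. \<bar>g w\<bar> \<le> B" and X: "integrable M X"
  shows "integrable M (\<lambda>w. real_cond_exp M F g w * X w)"
proof (rule Bochner_Integration.integrable_bound)
  show "integrable M (\<lambda>w. B * X w)" using X by simp
  show "(\<lambda>w. real_cond_exp M F g w * X w) \<in> borel_measurable M" using X by measurable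
  have "AE w in M. real_cond_exp M F g w \<ge> - B" "AE w in M. real_cond_exp M F g w \<le> B"
    by (rule real_cond_exp_ge_c[OF g] real_cond_exp_le_c[OF g], use bound in eventually_elim, simp)+
  then show "AE w in M. norm (real_cond_exp M F g w * X w) \<le> norm (B * X w)"
    by eventually_elim (auto simp: abs_mult intro!: mult_right_mono)
qed

text \<open>Here \<open>h\<close> is an explicit \<open>F\<close>-measurable version of E[X | F].
  The defining property of conditional expectation is used twice: with multiplier \<open>h\<close>
  against \<open>g\<close>, and with multiplier E[g | F] against \<open>X\<close>. The bound on
  \<open>g\<close> supplies the integrability that both uses need.\<close>

lemma (in sigma_finite_subalgebra) integral_real_cond_exp_mult_eq:
  assumes g: "integrable M g" and bound: "AE w in M. \<bar>g w\<bar> \<le> B" and X: "integrable M X"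
    and h: "h \<in> borel_measurable F" "AE w in M. real_cond_exp M F X w = h w"
  shows "(\<integral>w. real_cond_exp M F g w * X w \<partial>M) = (\<integral>w. g w * h w \<partial>M)"
    and "(\<integral>w. real_cond_exp M F g w * real_cond_exp M F X w \<partial>M) = (\<integral>w. g w * h w \<partial>M)"
proof -
  have [measurable]: "h \<in> borel_measurable M" "g \<in> borel_measurable M" "X \<in> borel_measurable M"
    using h(1) g X by (auto intro: measurable_from_subalg[OF subalg])
  have inth: "integrable M h"
    using real_cond_exp_int(1)[OF X] h(2) by (subst integrable_cong_AE[symmetric]) auto
  have "integrable M (\<lambda>w. B * h w)" using inth by simp
  then have "integrable M (\<lambda>w. h w * g w)"
  proof (rule Bochner_Integration.integrable_bound)
    show "AE w in M. norm (h w * g w) \<le> norm (B * h w)"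
      using bound
      by eventually_elim (simp add: abs_mult mult.commute[of "\<bar>h _\<bar>"] mult_right_mono)
  qed simp
  then have "(\<integral>w. real_cond_exp M F g w * h w \<partial>M) = (\<integral>w. g w * h w \<partial>M)"
    using real_cond_exp_intg(2)[of h g] h(1) by (simp add: mult.commute)
  moreover have "(\<integral>w. real_cond_exp M F g w * real_cond_exp M F X w \<partial>M)
      = (\<integral>w. real_cond_exp M F g w * h w \<partial>M)"
    using h(2) by (intro integral_cong_AE) (auto elim!: AE_mp)
  moreover have "(\<integral>w. real_cond_exp M F g w * real_cond_exp M F X w \<partial>M)
      = (\<integral>w. real_cond_exp M F g w * X w \<partial>M)"
    by (rule real_cond_exp_intg(2)[OF integrable_real_cond_exp_mult_bounded[OF g bound X]]) auto
  ultimately show "(\<integral>w. real_cond_exp M F g w * X w \<partial>M) = (\<integral>w. g w * h w \<partial>M)"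
    and "(\<integral>w. real_cond_exp M F g w * real_cond_exp M F X w \<partial>M) = (\<integral>w. g w * h w \<partial>M)"
    by simp_all
qed

lemma subalgebra_vimage_algebra:
  assumes "Z \<in> measurable M N"
  shows "subalgebra M (vimage_algebra (space M) Z N)"
  using assms measurable_space[OF assms]
  by (auto simp: subalgebra_def Pi_iff sets_vimage_algebra2)

theorem proposition4p1:
  fixes M :: "'w measure"
    and alpha :: "'w \<Rightarrow> 'a::euclidean_space"
    and eps0 :: "'w \<Rightarrow> 'e0::euclidean_space"
    and eps1 :: "'w \<Rightarrow> 'e1::euclidean_space"
    and eps2 :: "'w \<Rightarrow> 'e2::euclidean_space"
    and mu :: "'w \<Rightarrow> 'm::euclidean_space"
    and eta0 :: "'w \<Rightarrow> 'h0::euclidean_space"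
    and eta1 :: "'w \<Rightarrow> 'h1::euclidean_space"
    and eta2 :: "'w \<Rightarrow> 'h2::euclidean_space"
    and xi0 :: "'a \<times> 'e0 \<Rightarrow> real"
    and xi1 :: "'a \<times> 'e1 \<Rightarrow> real"
    and xi2 :: "'a \<times> 'e2 \<Rightarrow> real"
    and Y0 Y1 :: "nat \<Rightarrow> 'w \<Rightarrow> real"
    and G zeta2 :: "'w \<Rightarrow> real"
    and rho1 rho2 :: real
    and omega :: "'w \<Rightarrow> 'a \<times> ('e0 \<times> 'e1) \<times> 'm \<times> ('h0 \<times> 'h1)"
  assumes "prob_space M"
    and "alpha \<in> borel_measurable M"
    and "eps0 \<in> borel_measurable M"
    and "eps1 \<in> borel_measurable M"
    and "eps2 \<in> borel_measurable M"
    and "mu \<in> borel_measurable M"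
    and "eta0 \<in> borel_measurable M"
    and "eta1 \<in> borel_measurable M"
    and "eta2 \<in> borel_measurable M"
    and "xi0 \<in> borel_measurable borel"
    and "xi1 \<in> borel_measurable borel"
    and "xi2 \<in> borel_measurable borel"
    and "\<And>w. w \<in> space M \<Longrightarrow> Y0 0 w = xi0 (alpha w, eps0 w)"
    and "\<And>w. w \<in> space M \<Longrightarrow> Y0 1 w = xi1 (alpha w, eps1 w)"
    and "\<And>w. w \<in> space M \<Longrightarrow> Y0 2 w = xi2 (alpha w, eps2 w)"
    and "\<And>t. t \<in> {0, 1, 2} \<Longrightarrow> integrable M (Y0 t)"
    and "\<And>t. t \<in> {0, 1, 2} \<Longrightarrow> Y1 t \<in> borel_measurable M"
    and "G \<in> borel_measurable M"
    and "\<And>w. w \<in> space M \<Longrightarrow> G w \<in> {0, 1}"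
    and no_anticipation: "\<And>t. t \<in> {0, 1} \<Longrightarrow> AE w in M. G w = 1 \<longrightarrow> Y1 t w = Y0 t w"
    and "measure M (group_event M G 1) \<in> {0<..<1}"
    and "\<And>w. omega w = (alpha w, (eps0 w, eps1 w), mu w, (eta0 w, eta1 w))"
    and "AE w in M. cond_exp_rv M (centered M (Y0 1)) (\<lambda>v. (alpha v, eps0 v, mu v, eta0 v)) w
           = rho1 * centered M (Y0 0) w"
    and "AE w in M. cond_exp_rv M (centered M (Y0 2))
             (\<lambda>v. (alpha v, (eps0 v, eps1 v), mu v, (eta0 v, eta1 v))) w
           = rho2 * centered M (Y0 1) w"
    and "\<And>w. zeta2 w = centered M (Y0 2) w - rho2 * centered M (Y0 1) w"
  shows "delta_sel_post M G omega Y0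
           = cond_exp_event M zeta2 (group_event M G 1)
             - cond_exp_event M zeta2 (group_event M G 0)
       \<and> delta_dev_post M G omega Y0
           = (rho2 - 1) * (cond_exp_event M (observed_outcome G Y0 Y1 1) (group_event M G 1)
                           - cond_exp_event M (observed_outcome G Y0 Y1 1) (group_event M G 0))"
proof -
  interpret prob_space M by fact
  define F where "F = vimage_algebra (space M) omega borel"
  define D where "D t = centered M (Y0 t)" for t
  let ?g = "group_event M G"
  note [measurable] = assms(2-12,18)
  have omega: "omega = (\<lambda>w. (alpha w, (eps0 w, eps1 w), mu w, (eta0 w, eta1 w)))"
    using assms(22) by auto
  have omega_meas: "omega \<in> borel_measurable M"
    unfolding omega by (intro borel_measurable_Pair) measurable
  have sub: "subalgebra M F"
    unfolding F_def by (rule subalgebra_vimage_algebra[OF omega_meas])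
  interpret finite_measure_subalgebra M F by standard (rule sub)
  have intY: "integrable M (Y0 1)" "integrable M (Y0 2)" using assms(16) by auto
  have intD: "integrable M (D 1)" "integrable M (D 2)"
    using intY by (auto simp: D_def centered_def[abs_def])
  have meanD: "expectation (D 1) = 0" "expectation (D 2) = 0"
    using intY by (auto simp: D_def centered_def[abs_def] prob_space)
  have G01: "G w \<in> {0, 1}" if "w \<in> space M" for w using assms(19)[OF that] .
  have bound: "AE w in M. \<bar>G w\<bar> \<le> 1" by (auto intro!: AE_I2 dest: G01)
  have intG: "integrable M G"
    by (rule integrable_const_bound[where B = 1]) (use bound in auto)
  have intGX: "integrable M (\<lambda>w. G w * X w)" if "integrable M X" for X :: "'w \<Rightarrow> real"
    by (rule Bochner_Integration.integrable_bound[OF that])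
      (use that in \<open>auto intro!: AE_I2 dest: G01\<close>)

  \<comment> \<open>\<open>Y0 1\<close> factors through \<open>omega\<close> by way of the
    projection onto the components \<open>alpha\<close> and \<open>eps1\<close>. Continuity makes
    this projection Borel, and hence \<open>D 1\<close> is measurable with respect to
    \<open>F\<close>.\<close>
  have "continuous_on UNIV (\<lambda>z :: 'a \<times> ('e0 \<times> 'e1) \<times> 'm \<times> ('h0 \<times> 'h1). (fst z, snd (fst (snd z))))"
    by (intro continuous_intros)
  then have proj: "(\<lambda>z :: 'a \<times> ('e0 \<times> 'e1) \<times> 'm \<times> ('h0 \<times> 'h1). (fst z, snd (fst (snd z))))
      \<in> borel_measurable borel"
    by (rule borel_measurable_continuous_onI)
  have "omega \<in> borel_measurable F"
    unfolding F_def by (rule measurable_vimage_algebra1) auto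
  from measurable_compose[OF measurable_compose[OF this proj] assms(11)]
  have "(\<lambda>w. xi1 (alpha w, eps1 w)) \<in> borel_measurable F"
    by (simp add: omega)
  moreover have "space F = space M" by (simp add: F_def)
  ultimately have "Y0 1 \<in> borel_measurable F"
    using assms(14) by (subst measurable_cong[where g = "\<lambda>w. xi1 (alpha w, eps1 w)"]) auto
  then have D1F: "D 1 \<in> borel_measurable F"
    unfolding D_def centered_def[abs_def] by measurable

  \<comment> \<open>The conditioning vector in the assumption for period 2 is \<open>omega\<close>
    itself, so the assumption is already a statement about \<open>F\<close>.\<close>
  have "AE w in M. real_cond_exp M F (D 2) w = rho2 * D 1 w"
    using assms(24) unfolding cond_exp_rv_def D_def F_def omega .
  moreover have "AE w in M. real_cond_exp M F (D 1) w = D 1 w"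
    by (rule real_cond_exp_F_meas[OF intD(1) D1F])
  moreover have "AE w in M. real_cond_exp M F (\<lambda>w. D 2 w - D 1 w) w
      = real_cond_exp M F (D 2) w - real_cond_exp M F (D 1) w"
    by (rule real_cond_exp_diff[OF intD(2,1)])
  ultimately have cond: "AE w in M. real_cond_exp M F (\<lambda>w. D 2 w - D 1 w) w = (rho2 - 1) * D 1 w"
    by eventually_elim (simp add: algebra_simps)
  have intX: "integrable M (\<lambda>w. D 2 w - D 1 w)" using intD by simp
  have hF: "(\<lambda>w. (rho2 - 1) * D 1 w) \<in> borel_measurable F" using D1F by measurable
  \<comment> \<open>Take g = G, B = 1, X = D 2 - D 1 and h = (rho2 - 1) D 1. The first equation
    serves the selection term, the second the deviation term.\<close>
  note adj = integral_real_cond_exp_mult_eq[OF intG bound intX hF cond]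
  have Gh: "expectation (\<lambda>w. G w * ((rho2 - 1) * D 1 w)) = (rho2 - 1) * expectation (\<lambda>w. G w * D 1 w)"
    by (simp only: mult.left_commute[of "G _" "rho2 - 1"] integral_mult_right_zero)

  have zeta: "zeta2 = (\<lambda>w. D 2 w - rho2 * D 1 w)" using assms(25) by (auto simp: D_def)
  have intz: "integrable M zeta2" using intD by (simp add: zeta)
  \<comment> \<open>Centering leaves \<open>zeta2\<close> unchanged, so the group difference of its
    means has numerator E[G zeta2].\<close>
  have "expectation zeta2 = 0" using intD meanD by (simp add: zeta)
  then have cz: "centered M zeta2 = zeta2" by (auto simp: centered_def)

  \<comment> \<open>After the subtracted term is rewritten by \<open>adj(1)\<close>, the factor
    multiplying \<open>G\<close> is D 2 - D 1 - (rho2 - 1) D 1 = D 2 - rho2 D 1, which is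
    \<open>zeta2\<close>.\<close>
  have "expectation (\<lambda>w. (G w - real_cond_exp M F G w) * (D 2 w - D 1 w))
      = expectation (\<lambda>w. G w * (D 2 w - D 1 w)) - expectation (\<lambda>w. G w * ((rho2 - 1) * D 1 w))"
    unfolding adj(1)[symmetric] left_diff_distrib[of "G _"]
    by (rule Bochner_Integration.integral_diff[OF intGX[OF intX]
        integrable_real_cond_exp_mult_bounded[OF intG bound intX]])
  also have "\<dots> = expectation (\<lambda>w. G w * (D 2 w - D 1 w) - G w * ((rho2 - 1) * D 1 w))"
    using intGX[OF intX] intGX[of "\<lambda>w. (rho2 - 1) * D 1 w"] intD by simp
  also have "\<dots> = expectation (\<lambda>w. G w * zeta2 w)"
    by (simp add: zeta algebra_simps)
  finally have sel: "delta_sel_post M G omega Y0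
      = expectation (\<lambda>w. G w * zeta2 w) / (prob (?g 1) * prob (?g 0))"
    by (simp add: delta_sel_post_def cond_exp_rv_def F_def D_def)
  have dev: "delta_dev_post M G omega Y0
      = (rho2 - 1) * (expectation (\<lambda>w. G w * D 1 w) / (prob (?g 1) * prob (?g 0)))"
    using adj(2) Gh by (simp add: delta_dev_post_def cond_exp_rv_def F_def D_def)

  have Y1m [measurable]: "Y1 1 \<in> borel_measurable M" "Y0 1 \<in> borel_measurable M"
    using assms(17) intY by auto
  have obsm: "observed_outcome G Y0 Y1 1 \<in> borel_measurable M"
    unfolding observed_outcome_def[abs_def] by measurable
  \<comment> \<open>On \<open>G = 1\<close> this is no anticipation in period 1; elsewhere the
    observed outcome is the untreated one by definition.\<close>
  have "AE w in M. observed_outcome G Y0 Y1 1 w = Y0 1 w"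
    using no_anticipation[of 1] by (auto simp: observed_outcome_def)
  then have obs: "cond_exp_event M (observed_outcome G Y0 Y1 1) (?g g) = cond_exp_event M (Y0 1) (?g g)"
    for g
    by (intro cond_exp_event_cong_AE group_event_sets assms(18) obsm Y1m(2)) auto
  have "G \<in> space M \<rightarrow> {0, 1}" using G01 by blast
  \<comment> \<open>Applied to the uncentered \<open>Y0 1\<close>, the formula produces E[G D 1],
    since its centering is \<open>D 1\<close>.\<close>
  note diff = cond_exp_event_group_diff[OF assms(18) this assms(21)]
  show ?thesis
    unfolding sel dev obs diff[OF intz] diff[OF intY(1)] cz D_def by simp
qed

end
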